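(* Let $0<\varepsilon<1$, let $B$ be a standard Brownian motion, and let $$M_B := \sup_{\substack{0<s<t<\infty,\\ h=|t-s|}} \frac{|B_t-B_s|}{\sqrt{h\left(1+\ln\frac{t}{h}+\varepsilon|\ln t|\right)}}.$$ Let $x_0,\overline{x}_0\in\mathbb{R}$, and let $b,\overline{b},\sigma,\overline{\sigma}:\mathbb{R}_+\times\mathbb{R}\to\mathbb{R}$ be such that $b,\overline{b}$ are LBC$(L_b,K_b,D_b)$ and $\sigma^2,\overline{\sigma}^2$ are LBC$(L_\sigma,K_\sigma,D_\sigma)$. Let $X$ and $\overline{X}$ be real-valued processes satisfying, for all $t\ge 0$, $$X(t)=x_0+\int_0^t b(s,X(s))\,ds+B(\Lambda(t)),\qquad \overline{X}(t)=\overline{x}_0+\int_0^t\overline{b}(s,\overline{X}(s))\,ds+B(\overline{\Lambda}(t)),$$ where $\Lambda(t):=\int_0^t\sigma(s,X(s))^2ds$ and $\overline{\Lambda}(t):=\int_0^t\overline{\sigma}(s,\overline{X}(s))^2ds$. Denote $X^*(t)=\sup_{0\le s\le t}|X(s)|$ and $\overline{X}^*(t)=\sup_{0\le s\le t}|\overline{X}(s)|$. Then for all $T>0$, $\gamma(T):=\sup_{0\le t\le T}|X(t)-\overline{X}(t)|$ satisfies $$\gamma(T)\le 1+2e^{2L_bT}\Big[|x_0-\overline{x}_0|+TD_b(X^*(T))+M_B\,w\big(TK_\sigma(X^*(T)),TD_\sigma(X^*(T))\big)+M_B^2\,w\big(TK_\sigma(X^*(T)+\overline{X}^*(T)),TL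_\sigma\big)^2\Big].$$
   Context: The function $w$ (depending on $\varepsilon\in(0,1)$) is defined on $\mathbb{R}_+^*\times\mathbb{R}_+^*$ by $w(t,h):=\sqrt{h\left(1+\ln\frac{t}{h}+\varepsilon|\ln t|\right)}$ if $0<h\le t$, and $w(t,h):=w(t,t)$ if $0<t<h$; it is extended by $w(t,h):=0$ if $t=0$ or $h=0$. Functions $g,\overline{g}:\mathbb{R}_+\times\mathbb{R}^d\to\mathbb{R}^k$ are said to be Lipschitz-bounded-close with constant $L$ and non-decreasing functions $K,D:\mathbb{R}_+\to\mathbb{R}_+$, abbreviated LBC$(L,K,D)$, if for all $t\in\mathbb{R}_+$ and $x,\overline{x}\in\mathbb{R}^d$: $|\overline{g}(t,x)-\overline{g}(t,\overline{x})|\le L|x-\overline{x}|$; $\max\{|g(t,x)|,|\overline{g}(t,x)|\}\le K(|x|)$; and $|g(t,x)-\overline{g}(t,x)|\le D(|x|)$. (The Lipschitz condition is only on the second function $\overline{g}$.) Standing assumption: the two equations for $X$ and $\overline{X}$ (driven by the same Brownian motion $B$) admit strong solutions with continuous paths. Inequalities between random variables are understood almost surely. *)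

theory Defs
  imports "HOL-Probability.Probability"
begin

text \<open>Functions on \<open>\<real>\<^sub>+\<close> are rendered as functions on \<^typ>\<open>real\<close> of which only the values at
  nonnegative arguments matter.\<close>

definition bm_modulus :: "real \<Rightarrow> real \<Rightarrow> real \<Rightarrow> real" where
  "bm_modulus \<epsilon> t h = sqrt (h * (1 + ln (t / h) + \<epsilon> * \<bar>ln t\<bar>))"

definition w :: "real \<Rightarrow> real \<Rightarrow> real \<Rightarrow> real" where
  "w \<epsilon> t h =
     (if 0 < h \<and> h \<le> t then bm_modulus \<epsilon> t h
      else if 0 < t \<and> t < h then bm_modulus \<epsilon> t t
      else 0)"

definition LBC ::
  "real \<Rightarrow> (real \<Rightarrow> real) \<Rightarrow> (real \<Rightarrow> real) \<Rightarrow>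
   (real \<Rightarrow> 'd::euclidean_space \<Rightarrow> 'k::euclidean_space) \<Rightarrow> (real \<Rightarrow> 'd \<Rightarrow> 'k) \<Rightarrow> bool" where
  "LBC L K D g g' \<longleftrightarrow>
     mono_on {0..} K \<and> (\<forall>r\<ge>0. 0 \<le> K r) \<and>
     mono_on {0..} D \<and> (\<forall>r\<ge>0. 0 \<le> D r) \<and>
     (\<forall>t\<ge>0. \<forall>x x'. norm (g' t x - g' t x') \<le> L * norm (x - x')) \<and>
     (\<forall>t\<ge>0. \<forall>x. max (norm (g t x)) (norm (g' t x)) \<le> K (norm x)) \<and>
     (\<forall>t\<ge>0. \<forall>x. norm (g t x - g' t x) \<le> D (norm x))"

definition standard_brownian_motion :: "'a measure \<Rightarrow> (real \<Rightarrow> 'a \<Rightarrow> real) \<Rightarrow> bool" where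
  "standard_brownian_motion M B \<longleftrightarrow>
     prob_space M \<and>
     (\<forall>t\<ge>0. B t \<in> borel_measurable M) \<and>
     (AE \<omega> in M. B 0 \<omega> = 0) \<and>
     (\<forall>s t. 0 \<le> s \<and> s < t \<longrightarrow>
        distributed M lborel (\<lambda>\<omega>. B t \<omega> - B s \<omega>) (normal_density 0 (sqrt (t - s)))) \<and>
     (\<forall>(n::nat) \<tau>. 0 \<le> \<tau> 0 \<and> strict_mono_on {..n} \<tau> \<longrightarrow>
        prob_space.indep_vars M (\<lambda>_. borel) (\<lambda>i \<omega>. B (\<tau> (Suc i)) \<omega> - B (\<tau> i) \<omega>) {..<n}) \<and>
     (AE \<omega> in M. continuous_on {0..} (\<lambda>t. B t \<omega>))"

text \<open>The supremum is taken in the extended reals, since on a null set it may be infinite.\<close>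

definition M_B :: "real \<Rightarrow> (real \<Rightarrow> 'a \<Rightarrow> real) \<Rightarrow> 'a \<Rightarrow> ereal" where
  "M_B \<epsilon> B \<omega> =
     (SUP (s, t) \<in> {(s, t). 0 < s \<and> s < t}.
        ereal (\<bar>B t \<omega> - B s \<omega>\<bar> / bm_modulus \<epsilon> t \<bar>t - s\<bar>))"

definition clock :: "(real \<Rightarrow> real \<Rightarrow> real) \<Rightarrow> (real \<Rightarrow> 'a \<Rightarrow> real) \<Rightarrow> real \<Rightarrow> 'a \<Rightarrow> real" where
  "clock \<sigma> X t \<omega> = (LINT s:{0..t}|lebesgue. (\<sigma> s (X s \<omega>))\<^sup>2)"

text \<open>Integrability is part of being a solution: the Bochner integral of a non-integrable function
  is zero by convention, and the coefficients are not otherwise assumed to be measurable.\<close>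

definition time_change_solution ::
  "'a measure \<Rightarrow> (real \<Rightarrow> 'a \<Rightarrow> real) \<Rightarrow> (real \<Rightarrow> real \<Rightarrow> real) \<Rightarrow> (real \<Rightarrow> real \<Rightarrow> real) \<Rightarrow>
   real \<Rightarrow> (real \<Rightarrow> 'a \<Rightarrow> real) \<Rightarrow> bool" where
  "time_change_solution M B b \<sigma> x\<^sub>0 X \<longleftrightarrow>
     (\<forall>t\<ge>0. X t \<in> borel_measurable M) \<and>
     (AE \<omega> in M.
        continuous_on {0..} (\<lambda>t. X t \<omega>) \<and>
        (\<forall>t\<ge>0.
           set_integrable lebesgue {0..t} (\<lambda>s. b s (X s \<omega>)) \<and>
           set_integrable lebesgue {0..t} (\<lambda>s. (\<sigma> s (X s \<omega>))\<^sup>2) \<and>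
           X t \<omega> = x\<^sub>0 + (LINT s:{0..t}|lebesgue. b s (X s \<omega>)) + B (clock \<sigma> X t \<omega>) \<omega>))"

definition running_max :: "(real \<Rightarrow> 'a \<Rightarrow> real) \<Rightarrow> real \<Rightarrow> 'a \<Rightarrow> real" where
  "running_max X t \<omega> = (SUP s\<in>{0..t}. \<bar>X s \<omega>\<bar>)"

end

theory Submission
  imports Defs
begin

text \<open>Off a null set the argument is pathwise. Up to time \<open>T\<close>, passing from \<open>\<Lambda>\<close> to \<open>\<Lambda>'\<close> through an
  intermediate clock value splits the Brownian increment into \<open>M\<^sub>B w(T K\<^sub>\<sigma>, T D\<^sub>\<sigma>)\<close> and
  \<open>M\<^sub>B w(T K\<^sub>\<sigma>, T L\<^sub>\<sigma> \<gamma>(T))\<close>. Both are constant in time, so Gronwall's lemma for the drift gives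
  \<open>\<gamma>(T) \<le> e\<^bsup>L\<^sub>b T\<^esup> (C + M\<^sub>B w(T K\<^sub>\<sigma>, T L\<^sub>\<sigma> \<gamma>(T)))\<close>. Since \<open>w(t,h)\<^sup>2 / h\<close> decreases in \<open>h\<close>, for
  \<open>\<gamma>(T) \<ge> 1\<close> a factor \<open>\<surd>\<gamma>(T)\<close> can be pulled out of \<open>w\<close> and absorbed by AM-GM, at the price of
  squaring \<open>M\<^sub>B w\<close> and \<open>e\<^bsup>L\<^sub>b T\<^esup>\<close>.\<close>

section \<open>Monotonicity and scaling of \<open>bm_modulus\<close> and of its extension
  \<open>w\<close>\<close>

lemma bm_modulus_nonneg:
  assumes "0 < h" "h \<le> t" "0 \<le> \<epsilon>"
  shows "0 \<le> bm_modulus \<epsilon> t h"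
proof -
  have "0 \<le> ln (t / h)" using assms by simp
  then show ?thesis using assms by (simp add: bm_modulus_def)
qed

lemma bm_modulus_pos:
  assumes "0 < h" "h \<le> t" "0 \<le> \<epsilon>"
  shows "0 < bm_modulus \<epsilon> t h"
proof -
  have "0 \<le> ln (t / h)" using assms by simp
  then have "0 < 1 + ln (t / h) + \<epsilon> * \<bar>ln t\<bar>" using assms
    by (intro add_pos_nonneg) auto
  then show ?thesis using assms by (simp add: bm_modulus_def)
qed

text \<open>In \<open>h\<close> the radicand has derivative
  \<open>ln (t / h) + \<epsilon> * \<bar>ln t\<bar>\<close>, nonnegative for
  \<open>h \<le> t\<close>. The inequality \<open>ln x \<le> x - 1\<close> at
  \<open>x = k / h\<close> replaces differentiation.\<close>

lemma bm_modulus_mono_right: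
  assumes "0 < h" "h \<le> k" "k \<le> t" "0 \<le> \<epsilon>"
  shows "bm_modulus \<epsilon> t h \<le> bm_modulus \<epsilon> t k"
proof -
  define a where "a = \<epsilon> * \<bar>ln t\<bar>"
  have a: "0 \<le> a" using assms by (simp add: a_def)
  have "ln (k / h) \<le> k / h - 1" using assms by (intro ln_le_minus_one) auto
  then have "h * ln (k / h) \<le> k - h" using assms by (simp add: field_simps)
  then have 1: "h * (ln k - ln h) \<le> k - h" using assms by (simp add: ln_div)
  have 2: "0 \<le> (k - h) * (ln t - ln k + a)" using assms a by (intro mult_nonneg_nonneg) auto
  have "h * (1 + (ln t - ln h) + a) \<le> k * (1 + (ln t - ln k) + a)"
    using 1 2 by (simp add: algebra_simps)
  then show ?thesis using assms by (simp add: bm_modulus_def a_def ln_div)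
qed

text \<open>For \<open>t < 1\<close> the term \<open>\<epsilon> * \<bar>ln t\<bar>\<close> falls as
  \<open>t\<close> grows, but thanks to \<open>\<epsilon> \<le> 1\<close> no faster than
  \<open>ln t\<close> rises.\<close>

lemma bm_modulus_mono_left:
  assumes "0 < h" "h \<le> s" "s \<le> t" "0 \<le> \<epsilon>" "\<epsilon> \<le> 1"
  shows "bm_modulus \<epsilon> s h \<le> bm_modulus \<epsilon> t h"
proof -
  have l: "ln s \<le> ln t" using assms by simp
  then have "\<bar>ln s\<bar> - \<bar>ln t\<bar> \<le> ln t - ln s" by linarith
  then have "\<epsilon> * (\<bar>ln s\<bar> - \<bar>ln t\<bar>) \<le> \<epsilon> * (ln t - ln s)" using assms by (intro mult_left_mono) auto
  also have "\<dots> \<le> 1 * (ln t - ln s)" using l assms by (intro mult_right_mono) auto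
  finally have "1 + (ln s - ln h) + \<epsilon> * \<bar>ln s\<bar> \<le> 1 + (ln t - ln h) + \<epsilon> * \<bar>ln t\<bar>"
    by (simp add: algebra_simps)
  then show ?thesis using assms by (simp add: bm_modulus_def ln_div)
qed

text \<open>The logarithmic factor decreases in \<open>h\<close>, so the radicand grows at most
  linearly in \<open>h\<close>, which leaves a factor \<open>sqrt c\<close> after taking
  roots.\<close>

lemma bm_modulus_scale:
  assumes "0 < h" "h \<le> k" "k \<le> c * h" "k \<le> t" "0 \<le> \<epsilon>"
  shows "bm_modulus \<epsilon> t k \<le> sqrt c * bm_modulus \<epsilon> t h"
proof -
  have "ln (t / k) \<le> ln (t / h)" using assms by (simp add: frac_le)
  then have 1: "1 + ln (t / k) + \<epsilon> * \<bar>ln t\<bar> \<le> 1 + ln (t / h) + \<epsilon> * \<bar>ln t\<bar>" by simp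
  have 2: "0 \<le> ln (t / k)" using assms by simp
  have "k * (1 + ln (t / k) + \<epsilon> * \<bar>ln t\<bar>) \<le> (c * h) * (1 + ln (t / h) + \<epsilon> * \<bar>ln t\<bar>)"
    using 1 2 assms by (intro mult_mono) auto
  then show ?thesis unfolding bm_modulus_def
    by (metis mult.assoc real_sqrt_le_iff real_sqrt_mult)
qed

text \<open>In this form the second argument of \<open>bm_modulus\<close> never exceeds the first,
  so the properties of \<open>w\<close> reduce to those of \<open>bm_modulus\<close> on its natural
  range.\<close>

lemma w_eq_min:
  "w \<epsilon> t h = (if 0 < t \<and> 0 < h then bm_modulus \<epsilon> t (min h t) else 0)"
  by (auto simp: w_def min_def)

lemma w_nonneg: "0 \<le> \<epsilon> \<Longrightarrow> 0 \<le> w \<epsilon> t h"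
  by (auto simp: w_eq_min intro!: bm_modulus_nonneg)

lemma w_eq_0_iff: "0 \<le> \<epsilon> \<Longrightarrow> w \<epsilon> t h = 0 \<longleftrightarrow> t \<le> 0 \<or> h \<le> 0"
  using bm_modulus_pos[of "min h t" t \<epsilon>] by (auto simp: w_eq_min)

lemma w_mono:
  assumes "s \<le> t" "h \<le> k" "0 \<le> \<epsilon>" "\<epsilon> \<le> 1"
  shows "w \<epsilon> s h \<le> w \<epsilon> t k"
proof (cases "0 < s \<and> 0 < h")
  case True
  \<comment> \<open>The time argument is enlarged first; then
    \<open>min h s \<le> min k t \<le> t\<close> leaves room to enlarge the increment.\<close>
  have "bm_modulus \<epsilon> s (min h s) \<le> bm_modulus \<epsilon> t (min h s)"
    using True assms by (intro bm_modulus_mono_left) auto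
  also have "\<dots> \<le> bm_modulus \<epsilon> t (min k t)"
    using True assms by (intro bm_modulus_mono_right) auto
  finally show ?thesis using True assms by (simp add: w_eq_min)
next
  case False
  then have "w \<epsilon> s h = 0" by (auto simp: w_eq_min)
  then show ?thesis using w_nonneg assms by simp
qed

lemma w_scale:
  assumes "1 \<le> c" "0 \<le> \<epsilon>"
  shows "w \<epsilon> t (c * h) \<le> sqrt c * w \<epsilon> t h"
proof (cases "0 < t \<and> 0 < h")
  case True
  have "h \<le> c * h" "t \<le> c * t" using True assms by auto
  then have "min h t \<le> min (c * h) t" "min (c * h) t \<le> c * min h t"
    unfolding min_def by (auto split: if_splits)
  then have "bm_modulus \<epsilon> t (min (c * h) t) \<le> sqrt c * bm_modulus \<epsilon> t (min h t)"
    using True assms by (intro bm_modulus_scale) auto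
  then show ?thesis using True assms by (simp add: w_eq_min)
next
  case False
  then show ?thesis using assms by (auto simp: w_eq_min zero_less_mult_iff)
qed

section \<open>Increments of a path bounded by \<open>w\<close>\<close>

lemma increment_le_w:
  fixes \<beta> :: "real \<Rightarrow> real"
  assumes \<epsilon>: "0 \<le> \<epsilon>" "\<epsilon> \<le> 1" and "0 \<le> m" and cont: "continuous_on {0..} \<beta>"
    and incr: "\<And>s t. 0 < s \<Longrightarrow> s < t \<Longrightarrow> \<bar>\<beta> t - \<beta> s\<bar> \<le> m * bm_modulus \<epsilon> t (t - s)"
    and "0 \<le> u" "u \<le> v" "v \<le> A" "v - u \<le> h"
  shows "\<bar>\<beta> v - \<beta> u\<bar> \<le> m * w \<epsilon> A h"
proof -
  have pos: "\<bar>\<beta> v - \<beta> u\<bar> \<le> m * w \<epsilon> v (v - u)" if "0 < u" "u \<le> v" for u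
  proof (cases "u = v")
    case True
    then show ?thesis using \<epsilon> \<open>0 \<le> m\<close> by (simp add: w_nonneg)
  next
    case False
    then show ?thesis using incr[of u v] that by (simp add: w_def)
  qed
  have "\<bar>\<beta> v - \<beta> u\<bar> \<le> m * w \<epsilon> v (v - u)"
  proof (cases "0 < u \<or> v = 0")
    case True
    then show ?thesis using pos assms by (auto simp: w_nonneg)
  next
    case False
    then have u: "u = 0" and v: "0 < v" using assms by auto
    \<comment> \<open>Like the supremum in \<open>M_B\<close>, \<open>incr\<close> speaks of
      positive left ends only; the left end 0 is reached as a limit, by continuity of
      \<open>\<beta>\<close>.\<close>
    have "(\<beta> \<longlongrightarrow> \<beta> 0) (at 0 within {0..})" using cont by (simp add: continuous_on_def)
    then have lim: "(\<beta> \<longlongrightarrow> \<beta> 0) (at_right 0)" by (rule tendsto_within_subset) auto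
    have "((\<lambda>s. \<bar>\<beta> v - \<beta> s\<bar>) \<longlongrightarrow> \<bar>\<beta> v - \<beta> 0\<bar>) (at_right 0)"
      by (intro tendsto_intros lim)
    moreover have "eventually (\<lambda>s. \<bar>\<beta> v - \<beta> s\<bar> \<le> m * w \<epsilon> v v) (at_right 0)"
      using eventually_at_right_real[OF v]
    proof (eventually_elim)
      case (elim s)
      then have "\<bar>\<beta> v - \<beta> s\<bar> \<le> m * w \<epsilon> v (v - s)" using pos by auto
      \<comment> \<open>Monotonicity of \<open>w\<close> makes the bound independent of
        \<open>s\<close>, so it survives the limit.\<close>
      also have "\<dots> \<le> m * w \<epsilon> v v"
        using elim \<epsilon> \<open>0 \<le> m\<close> by (intro mult_left_mono w_mono) auto
      finally show ?case .
    qed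
    ultimately show ?thesis using u tendsto_upperbound[of _ _ "at_right (0::real)"] by fastforce
  qed
  also have "\<dots> \<le> m * w \<epsilon> A h"
    using assms by (intro mult_left_mono w_mono) auto
  finally show ?thesis .
qed

lemma increment_le_w_symmetric:
  fixes \<beta> :: "real \<Rightarrow> real"
  assumes \<epsilon>: "0 \<le> \<epsilon>" "\<epsilon> \<le> 1" and m: "0 \<le> m" and \<beta>: "continuous_on {0..} \<beta>"
    and incr: "\<And>s t. 0 < s \<Longrightarrow> s < t \<Longrightarrow> \<bar>\<beta> t - \<beta> s\<bar> \<le> m * bm_modulus \<epsilon> t (t - s)"
    and "0 \<le> u" "0 \<le> v" "u \<le> A" "v \<le> A" "\<bar>u - v\<bar> \<le> h"
  shows "\<bar>\<beta> u - \<beta> v\<bar> \<le> m * w \<epsilon> A h"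
proof -
  note le = increment_le_w[OF \<epsilon> m \<beta> incr]
  show ?thesis
  proof (cases "u \<le> v")
    case True
    then have "\<bar>\<beta> v - \<beta> u\<bar> \<le> m * w \<epsilon> A h" using assms(6-) by (intro le) linarith+
    then show ?thesis by (simp add: abs_minus_commute)
  next
    case False
    then show ?thesis using assms(6-) by (intro le) linarith+
  qed
qed

section \<open>Gronwall's lemma in integral form\<close>

lemma gronwall_integral:
  fixes u :: "real \<Rightarrow> real"
  assumes cont: "continuous_on {0..T} u" and "0 \<le> L"
    and bound: "\<And>t. t \<in> {0..T} \<Longrightarrow> u t \<le> G + L * integral {0..t} u"
    and t: "t \<in> {0..T}"
  shows "u t \<le> G * exp (L * t)"
proof -
  \<comment> \<open>With this integrating factor the derivative of \<open>\<phi>\<close> is a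
    nonnegative multiple of \<open>u s - (G + L * integral {0..s} u)\<close>, which
    \<open>bound\<close> makes nonpositive; hence
    \<open>\<phi> t \<le> \<phi> 0 = G\<close>.\<close>
  define \<phi> where "\<phi> s = exp (- (L * s)) * (G + L * integral {0..s} u)" for s
  have ct: "continuous_on {0..t} u" using cont t by (auto intro: continuous_on_subset)
  have der: "(\<phi> has_real_derivative L * exp (- (L * s)) * (u s - (G + L * integral {0..s} u)))
      (at s within {0..t})" if "s \<in> {0..t}" for s
    unfolding \<phi>_def
    by (auto intro!: derivative_eq_intros integral_has_real_derivative[OF ct that]
        simp: algebra_simps)
  have "\<phi> t \<le> \<phi> 0"
  proof (rule DERIV_nonpos_imp_decreasing_open[where f = \<phi>])
    show "0 \<le> t" using t by simp
    show "continuous_on {0..t} \<phi>"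
      using der by (rule DERIV_continuous_on)
    fix s assume s: "0 < s" "s < t"
    then have "(\<phi> has_real_derivative L * exp (- (L * s)) * (u s - (G + L * integral {0..s} u))) (at s)"
      using der[of s] by (simp add: at_within_Icc_at)
    moreover have "L * exp (- (L * s)) * (u s - (G + L * integral {0..s} u)) \<le> 0"
      using bound[of s] s t \<open>0 \<le> L\<close> by (intro mult_nonneg_nonpos) auto
    ultimately show "\<exists>y. (\<phi> has_real_derivative y) (at s) \<and> y \<le> 0" by blast
  qed
  then have "exp (- (L * t)) * (G + L * integral {0..t} u) \<le> G" by (simp add: \<phi>_def)
  then have "G + L * integral {0..t} u \<le> G * exp (L * t)"
    by (simp add: exp_minus field_simps)
  then show ?thesis using bound[OF t] by simp
qed

section \<open>Consequences of the \<open>LBC\<close> conditions\<close>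

lemma LBC_mono:
  assumes "LBC L K D g g'" "0 \<le> r" "r \<le> r'"
  shows "K r \<le> K r'" "D r \<le> D r'" "0 \<le> K r" "0 \<le> D r"
  using assms mono_onD[of "{0..}" K r r'] mono_onD[of "{0..}" D r r'] by (auto simp: LBC_def)

text \<open>The sign of \<open>L\<close> is not written into \<open>LBC\<close>; the Lipschitz
  condition at two points of distance 1 forces it.\<close>

lemma LBC_lipschitz_nonneg:
  fixes g g' :: "real \<Rightarrow> 'd::euclidean_space \<Rightarrow> 'k::euclidean_space"
  assumes "LBC L K D g g'"
  shows "0 \<le> L"
proof -
  obtain e :: 'd where "e \<in> Basis" using nonempty_Basis by (meson ex_in_conv)
  then have e: "norm e = 1" by (rule norm_Basis)
  have "norm (g' 0 e - g' 0 0) \<le> L * norm (e - 0)"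
    using assms unfolding LBC_def by blast
  then have "norm (g' 0 e - g' 0 0) \<le> L" using e by simp
  then show ?thesis using norm_ge_zero[of "g' 0 e - g' 0 0"] by linarith
qed

lemma LBC_lipschitz:
  assumes "LBC L K D g g'" "0 \<le> s"
  shows "norm (g' s x - g' s y) \<le> L * norm (x - y)"
  using assms by (simp add: LBC_def)

text \<open>Only \<open>g'\<close> is Lipschitz, so \<open>g\<close> is exchanged for
  \<open>g'\<close> at \<open>x\<close> before \<open>x\<close> is exchanged for \<open>y\<close>.
  Hence \<open>D\<close> sees the first solution only.\<close>

lemma LBC_diff_le:
  assumes "LBC L K D g g'" "0 \<le> s" "norm x \<le> r"
  shows "norm (g s x - g' s y) \<le> D r + L * norm (x - y)"
proof -
  have "norm (g s x - g' s x) \<le> D (norm x)"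
    using assms by (simp add: LBC_def)
  moreover have "D (norm x) \<le> D r"
    using LBC_mono(2)[OF assms(1) norm_ge_zero assms(3)] .
  moreover have "norm (g s x - g' s y) \<le> norm (g s x - g' s x) + norm (g' s x - g' s y)"
    using norm_triangle_ineq[of "g s x - g' s x" "g' s x - g' s y"] by simp
  ultimately show ?thesis using LBC_lipschitz[OF assms(1,2), of x y] by linarith
qed

lemma LBC_norm_le:
  assumes "LBC L K D g g'" "0 \<le> s" "norm x \<le> r"
  shows "norm (g s x) \<le> K r" "norm (g' s x) \<le> K r"
proof -
  have "max (norm (g s x)) (norm (g' s x)) \<le> K (norm x)"
    using assms by (simp add: LBC_def)
  moreover have "K (norm x) \<le> K r"
    using LBC_mono(1)[OF assms(1) norm_ge_zero assms(3)] .
  ultimately show "norm (g s x) \<le> K r" "norm (g' s x) \<le> K r" by auto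
qed

section \<open>Comparison of integrals and of clock values\<close>

lemma set_integral_diff_le:
  fixes f g k :: "real \<Rightarrow> real"
  assumes f: "set_integrable lebesgue {0..t} f" and g: "set_integrable lebesgue {0..t} g"
    and k: "continuous_on {0..t} k" and "0 \<le> t"
    and bound: "\<And>s. s \<in> {0..t} \<Longrightarrow> \<bar>f s - g s\<bar> \<le> d + L * k s"
  shows "\<bar>(LINT s:{0..t}|lebesgue. f s) - (LINT s:{0..t}|lebesgue. g s)\<bar>
      \<le> t * d + L * integral {0..t} k"
proof -
  \<comment> \<open>The Lebesgue integrals of the equations are turned into gauge integrals, the
    form in which \<open>gronwall_integral\<close> takes the gap.\<close>
  note F = set_lebesgue_integral_eq_integral[OF f] and G = set_lebesgue_integral_eq_integral[OF g]
  have k': "k integrable_on {0..t}" using k by (rule integrable_continuous_real)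
  have "norm (integral {0..t} (\<lambda>s. f s - g s)) \<le> integral {0..t} (\<lambda>s. d + L * k s)"
  proof (rule integral_norm_bound_integral)
    show "(\<lambda>s. f s - g s) integrable_on {0..t}" using F(1) G(1) by (rule integrable_diff)
    show "(\<lambda>s. d + L * k s) integrable_on {0..t}"
      by (intro integrable_continuous_real continuous_intros k)
  qed (use bound in auto)
  also have "integral {0..t} (\<lambda>s. d + L * k s) = t * d + L * integral {0..t} k"
    using k' \<open>0 \<le> t\<close> by (subst integral_add) (auto intro!: integrable_on_mult_right)
  finally show ?thesis using F G by (simp add: integral_diff)
qed

text \<open>In the application \<open>u\<close> stands for \<open>\<integral>\<^sub>0\<^sup>t \<sigma>'(s, X(s))\<^sup>2 ds\<close>, which need not exist because \<open>\<sigma>'\<close> is not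
  assumed to be measurable.\<close>

lemma intermediate_clock:
  fixes \<Lambda> \<Lambda>' a c A :: real
  assumes "\<bar>\<Lambda> - \<Lambda>'\<bar> \<le> a + c" "0 \<le> a" "0 \<le> c" "0 \<le> \<Lambda>" "0 \<le> \<Lambda>'" "\<Lambda> \<le> A" "\<Lambda>' \<le> A + c"
  obtains u where "0 \<le> u" "u \<le> A" "\<bar>\<Lambda> - u\<bar> \<le> a" "\<bar>u - \<Lambda>'\<bar> \<le> c"
proof
  \<comment> \<open>From \<open>\<Lambda>\<close> one moves towards \<open>\<Lambda>'\<close> by at
    most \<open>a\<close>, never past \<open>\<Lambda>'\<close> and, when moving up, never above
    \<open>A\<close>. If \<open>A\<close> is what stops the move, the hypothesis
    \<open>\<Lambda>' \<le> A + c\<close> bounds the remaining distance.\<close>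
  let ?u = "if \<Lambda> \<le> \<Lambda>' then min (min (\<Lambda> + a) \<Lambda>') A else max \<Lambda>' (\<Lambda> - a)"
  show "0 \<le> ?u" "?u \<le> A" "\<bar>\<Lambda> - ?u\<bar> \<le> a" "\<bar>?u - \<Lambda>'\<bar> \<le> c"
    using assms by (auto simp: min_def max_def)
qed

lemma continuous_le_SUP:
  fixes f :: "real \<Rightarrow> real"
  assumes "continuous_on {a..b} f" "s \<in> {a..b}"
  shows "f s \<le> (SUP s\<in>{a..b}. f s)"
proof (rule cSUP_upper[OF assms(2)])
  have "compact (f ` {a..b})" using assms(1) by (rule compact_continuous_image) simp
  then show "bdd_above (f ` {a..b})" by (intro bounded_imp_bdd_above compact_imp_bounded)
qed

section \<open>Deterministic estimates along one sample path, with \<open>\<beta>\<close> in the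
  role of the path of \<open>B\<close>\<close>

context
  fixes X X' :: "real \<Rightarrow> 'a \<Rightarrow> real" and \<omega> :: 'a and \<beta> :: "real \<Rightarrow> real"
    and b b' \<sigma> \<sigma>' :: "real \<Rightarrow> real \<Rightarrow> real"
    and K\<^sub>b D\<^sub>b K\<^sub>\<sigma> D\<^sub>\<sigma> :: "real \<Rightarrow> real"
    and L\<^sub>b L\<^sub>\<sigma> x\<^sub>0 x\<^sub>0' T :: real
  assumes LBC_b: "LBC L\<^sub>b K\<^sub>b D\<^sub>b b b'"
    and LBC_\<sigma>: "LBC L\<^sub>\<sigma> K\<^sub>\<sigma> D\<^sub>\<sigma> (\<lambda>t x. (\<sigma> t x)\<^sup>2) (\<lambda>t x. (\<sigma>' t x)\<^sup>2)"
    and T: "0 < T"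
    and cont: "continuous_on {0..} (\<lambda>t. X t \<omega>)" "continuous_on {0..} (\<lambda>t. X' t \<omega>)"
    and integrable:
      "\<And>t. 0 \<le> t \<Longrightarrow> set_integrable lebesgue {0..t} (\<lambda>s. b s (X s \<omega>))"
      "\<And>t. 0 \<le> t \<Longrightarrow> set_integrable lebesgue {0..t} (\<lambda>s. b' s (X' s \<omega>))"
      "\<And>t. 0 \<le> t \<Longrightarrow> set_integrable lebesgue {0..t} (\<lambda>s. (\<sigma> s (X s \<omega>))\<^sup>2)"
      "\<And>t. 0 \<le> t \<Longrightarrow> set_integrable lebesgue {0..t} (\<lambda>s. (\<sigma>' s (X' s \<omega>))\<^sup>2)"
    and equation:
      "\<And>t. 0 \<le> t \<Longrightarrow> X t \<omega> = x\<^sub>0 + (LINT s:{0..t}|lebesgue. b s (X s \<omega>)) + \<beta> (clock \<sigma> X t \<omega>)"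
      "\<And>t. 0 \<le> t \<Longrightarrow> X' t \<omega> = x\<^sub>0' + (LINT s:{0..t}|lebesgue. b' s (X' s \<omega>)) + \<beta> (clock \<sigma>' X' t \<omega>)"
begin

private abbreviation (input) "r \<equiv> running_max X T \<omega>"
private abbreviation (input) "r' \<equiv> running_max X' T \<omega>"
private abbreviation (input) "\<gamma> \<equiv> SUP t\<in>{0..T}. \<bar>X t \<omega> - X' t \<omega>\<bar>"

lemma continuous_diff: "continuous_on {0..} (\<lambda>t. \<bar>X t \<omega> - X' t \<omega>\<bar>)"
  by (intro continuous_intros cont)

lemma path_bounds:
  assumes "s \<in> {0..T}"
  shows "\<bar>X s \<omega>\<bar> \<le> r" "\<bar>X' s \<omega>\<bar> \<le> r'" "\<bar>X s \<omega> - X' s \<omega>\<bar> \<le> \<gamma>"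
proof -
  have c: "continuous_on {0..T} (\<lambda>t. X t \<omega>)" "continuous_on {0..T} (\<lambda>t. X' t \<omega>)"
    using cont by (auto intro: continuous_on_subset)
  show "\<bar>X s \<omega>\<bar> \<le> r" "\<bar>X' s \<omega>\<bar> \<le> r'" "\<bar>X s \<omega> - X' s \<omega>\<bar> \<le> \<gamma>"
    unfolding running_max_def
    using assms c continuous_le_SUP[of 0 T "\<lambda>s. \<bar>X s \<omega>\<bar>" s] continuous_le_SUP[of 0 T "\<lambda>s. \<bar>X' s \<omega>\<bar>" s]
      continuous_le_SUP[of 0 T "\<lambda>s. \<bar>X s \<omega> - X' s \<omega>\<bar>" s]
    by (simp_all add: continuous_on_diff continuous_on_rabs)
qed

lemma suprema_nonneg: "0 \<le> r" "0 \<le> r'" "0 \<le> \<gamma>"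
  using path_bounds[of 0] T by auto

text \<open>The driver's contribution \<open>N\<close> is uniform in time, so it joins the constant
  in Gronwall's lemma and only the drift is iterated. The degenerate case uses
  \<open>N = 0\<close>.\<close>

lemma gap_le:
  assumes N: "\<And>t. t \<in> {0..T} \<Longrightarrow> \<bar>\<beta> (clock \<sigma> X t \<omega>) - \<beta> (clock \<sigma>' X' t \<omega>)\<bar> \<le> N"
  shows "\<gamma> \<le> exp (L\<^sub>b * T) * (\<bar>x\<^sub>0 - x\<^sub>0'\<bar> + T * D\<^sub>b r + N)"
proof -
  let ?u = "\<lambda>t. \<bar>X t \<omega> - X' t \<omega>\<bar>"
  define G where "G = \<bar>x\<^sub>0 - x\<^sub>0'\<bar> + T * D\<^sub>b r + N"
  have L: "0 \<le> L\<^sub>b" by (rule LBC_lipschitz_nonneg[OF LBC_b])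
  have D: "0 \<le> D\<^sub>b r" using LBC_mono[OF LBC_b suprema_nonneg(1)] by blast
  have "0 \<le> N" using N[of 0] T by force
  then have G: "0 \<le> G" using D T by (simp add: G_def)
  have integral_bound: "?u t \<le> G + L\<^sub>b * integral {0..t} ?u" if t: "t \<in> {0..T}" for t
  proof -
    let ?I = "LINT s:{0..t}|lebesgue. b s (X s \<omega>)" and ?I' = "LINT s:{0..t}|lebesgue. b' s (X' s \<omega>)"
    have "\<bar>?I - ?I'\<bar> \<le> t * D\<^sub>b r + L\<^sub>b * integral {0..t} ?u"
    proof (rule set_integral_diff_le)
      show "continuous_on {0..t} ?u" using continuous_diff by (rule continuous_on_subset) auto
      fix s assume "s \<in> {0..t}"
      then show "\<bar>b s (X s \<omega>) - b' s (X' s \<omega>)\<bar> \<le> D\<^sub>b r + L\<^sub>b * ?u s"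
        using LBC_diff_le[OF LBC_b, of s "X s \<omega>" r "X' s \<omega>"] path_bounds(1)[of s] t by simp
    qed (use integrable t in auto)
    moreover have "t * D\<^sub>b r \<le> T * D\<^sub>b r" using t D by (intro mult_right_mono) auto
    ultimately show ?thesis
      using N[OF t] equation[of t] t unfolding G_def by simp
  qed
  have "?u t \<le> exp (L\<^sub>b * T) * G" if t: "t \<in> {0..T}" for t
  proof -
    have "?u t \<le> G * exp (L\<^sub>b * t)"
      using integral_bound continuous_on_subset[OF continuous_diff] L t
      by (intro gronwall_integral[of T]) auto
    \<comment> \<open>Replacing \<open>t\<close> by \<open>T\<close> in the exponent uses the sign
      of \<open>G\<close>.\<close>
    also have "\<dots> \<le> G * exp (L\<^sub>b * T)"
      using t L G by (intro mult_left_mono) (auto intro: mult_left_mono)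
    finally show ?thesis by (simp add: mult.commute)
  qed
  then show ?thesis using T by (intro cSUP_least) (auto simp: G_def)
qed

lemma clock_diff_le:
  assumes t: "t \<in> {0..T}"
    and bound: "\<And>s. s \<in> {0..T} \<Longrightarrow> \<bar>(\<sigma> s (X s \<omega>))\<^sup>2 - (\<sigma>' s (X' s \<omega>))\<^sup>2\<bar> \<le> d"
  shows "\<bar>clock \<sigma> X t \<omega> - clock \<sigma>' X' t \<omega>\<bar> \<le> T * d"
proof -
  have "0 \<le> d" using bound[of 0] T by force
  then have "t * d \<le> T * d" using t by (intro mult_right_mono) auto
  moreover have "\<bar>clock \<sigma> X t \<omega> - clock \<sigma>' X' t \<omega>\<bar> \<le> t * d + 0 * integral {0..t} (\<lambda>_. 0)"
    unfolding clock_def using t bound by (intro set_integral_diff_le integrable) auto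
  ultimately show ?thesis by simp
qed

lemma clock_bounds:
  assumes t: "t \<in> {0..T}"
  shows "0 \<le> clock \<sigma> X t \<omega>" "0 \<le> clock \<sigma>' X' t \<omega>"
    and "\<And>d. (\<And>s. s \<in> {0..T} \<Longrightarrow> (\<sigma> s (X s \<omega>))\<^sup>2 \<le> d) \<Longrightarrow> clock \<sigma> X t \<omega> \<le> T * d"
    and "\<And>d. (\<And>s. s \<in> {0..T} \<Longrightarrow> (\<sigma>' s (X' s \<omega>))\<^sup>2 \<le> d) \<Longrightarrow> clock \<sigma>' X' t \<omega> \<le> T * d"
proof -
  have le: "(LINT s:{0..t}|lebesgue. f s) \<le> T * d"
    if f: "set_integrable lebesgue {0..t} f" "\<And>s. 0 \<le> f s" "\<And>s. s \<in> {0..T} \<Longrightarrow> f s \<le> d"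
    for f :: "real \<Rightarrow> real" and d
  proof -
    have "0 \<le> d" using f(2)[of 0] f(3)[of 0] T by force
    then have "t * d \<le> T * d" using t by (intro mult_right_mono) auto
    \<comment> \<open>A single integral is bounded by comparing \<open>f\<close> with the zero
      function.\<close>
    moreover have "\<bar>(LINT s:{0..t}|lebesgue. f s) - (LINT s:{0..t}|lebesgue. 0)\<bar>
        \<le> t * d + 0 * integral {0..t} (\<lambda>_. 0)"
      using t f by (intro set_integral_diff_le) (auto simp: set_integrable_def)
    ultimately show ?thesis by (simp add: set_lebesgue_integral_def)
  qed
  show "0 \<le> clock \<sigma> X t \<omega>" "0 \<le> clock \<sigma>' X' t \<omega>"
    by (auto simp: clock_def set_lebesgue_integral_def intro!: integral_nonneg_AE)
  show "clock \<sigma> X t \<omega> \<le> T * d" if "\<And>s. s \<in> {0..T} \<Longrightarrow> (\<sigma> s (X s \<omega>))\<^sup>2 \<le> d" for d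
    unfolding clock_def using that t by (intro le integrable) auto
  show "clock \<sigma>' X' t \<omega> \<le> T * d" if "\<And>s. s \<in> {0..T} \<Longrightarrow> (\<sigma>' s (X' s \<omega>))\<^sup>2 \<le> d" for d
    unfolding clock_def using that t by (intro le integrable) auto
qed

text \<open>The path from one clock value to the other is cut at \<open>u\<close>. The first leg has
  length at most \<open>T * D\<^sub>\<sigma> r\<close> and stays below
  \<open>T * K\<^sub>\<sigma> r\<close>. The second has length at most
  \<open>\<gamma> * (T * L\<^sub>\<sigma>)\<close>; the argument \<open>r + r'\<close> of
  \<open>K\<^sub>\<sigma>\<close> covers both \<open>u\<close> and the clock of
  \<open>X'\<close>.\<close>

lemma clock_increment_le:
  assumes \<epsilon>: "0 \<le> \<epsilon>" "\<epsilon> \<le> 1" and m: "0 \<le> m" and \<beta>: "continuous_on {0..} \<beta>"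
    and incr: "\<And>s t. 0 < s \<Longrightarrow> s < t \<Longrightarrow> \<bar>\<beta> t - \<beta> s\<bar> \<le> m * bm_modulus \<epsilon> t (t - s)"
    and t: "t \<in> {0..T}"
  shows "\<bar>\<beta> (clock \<sigma> X t \<omega>) - \<beta> (clock \<sigma>' X' t \<omega>)\<bar>
    \<le> m * w \<epsilon> (T * K\<^sub>\<sigma> r) (T * D\<^sub>\<sigma> r) + m * w \<epsilon> (T * K\<^sub>\<sigma> (r + r')) (\<gamma> * (T * L\<^sub>\<sigma>))"
proof -
  let ?\<Lambda> = "clock \<sigma> X t \<omega>" and ?\<Lambda>' = "clock \<sigma>' X' t \<omega>"
  have L: "0 \<le> L\<^sub>\<sigma>" by (rule LBC_lipschitz_nonneg[OF LBC_\<sigma>])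
  have KD: "0 \<le> D\<^sub>\<sigma> r" "K\<^sub>\<sigma> r \<le> K\<^sub>\<sigma> (r + r')"
    using LBC_mono[OF LBC_\<sigma>, of r "r + r'"] suprema_nonneg by auto
  have gap: "L\<^sub>\<sigma> * \<bar>X s \<omega> - X' s \<omega>\<bar> \<le> L\<^sub>\<sigma> * \<gamma>" if "s \<in> {0..T}" for s
    using path_bounds(3)[OF that] L by (rule mult_left_mono)
  have \<sigma>: "(\<sigma> s (X s \<omega>))\<^sup>2 \<le> K\<^sub>\<sigma> r"
    and \<sigma>': "(\<sigma>' s (X' s \<omega>))\<^sup>2 \<le> K\<^sub>\<sigma> (r + r')"
    and \<sigma>'_lip: "(\<sigma>' s (X' s \<omega>))\<^sup>2 \<le> K\<^sub>\<sigma> r + L\<^sub>\<sigma> * \<gamma>"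
    and \<sigma>_diff: "\<bar>(\<sigma> s (X s \<omega>))\<^sup>2 - (\<sigma>' s (X' s \<omega>))\<^sup>2\<bar> \<le> D\<^sub>\<sigma> r + L\<^sub>\<sigma> * \<gamma>"
    if s: "s \<in> {0..T}" for s
  proof -
    show "(\<sigma> s (X s \<omega>))\<^sup>2 \<le> K\<^sub>\<sigma> r"
      using LBC_norm_le(1)[OF LBC_\<sigma>, of s "X s \<omega>" r] path_bounds(1)[OF s] s by simp
    show "(\<sigma>' s (X' s \<omega>))\<^sup>2 \<le> K\<^sub>\<sigma> (r + r')"
      using LBC_norm_le(2)[OF LBC_\<sigma>, of s "X' s \<omega>" "r + r'"] path_bounds(2)[OF s] suprema_nonneg s
      by simp
    show "(\<sigma>' s (X' s \<omega>))\<^sup>2 \<le> K\<^sub>\<sigma> r + L\<^sub>\<sigma> * \<gamma>"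
      using LBC_norm_le(2)[OF LBC_\<sigma>, of s "X s \<omega>" r] path_bounds(1)[OF s] gap[OF s] s
        LBC_lipschitz[OF LBC_\<sigma>, of s "X s \<omega>" "X' s \<omega>"] by simp
    show "\<bar>(\<sigma> s (X s \<omega>))\<^sup>2 - (\<sigma>' s (X' s \<omega>))\<^sup>2\<bar> \<le> D\<^sub>\<sigma> r + L\<^sub>\<sigma> * \<gamma>"
      using LBC_diff_le[OF LBC_\<sigma>, of s "X s \<omega>" r "X' s \<omega>"] path_bounds(1)[OF s] gap[OF s] s
      by simp
  qed
  have \<Lambda>: "?\<Lambda> \<le> T * K\<^sub>\<sigma> r" using \<sigma> by (intro clock_bounds(3) t)
  have \<Lambda>': "?\<Lambda>' \<le> T * K\<^sub>\<sigma> (r + r')" using \<sigma>' by (intro clock_bounds(4) t)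
  \<comment> \<open>This second bound on the clock of \<open>X'\<close>, obtained by evaluating
    \<open>\<sigma>'\<close> along \<open>X\<close> first, is the last hypothesis of
    \<open>intermediate_clock\<close> with \<open>A = T * K\<^sub>\<sigma> r\<close>. It keeps
    \<open>r'\<close> out of the first leg.\<close>
  have "?\<Lambda>' \<le> T * (K\<^sub>\<sigma> r + L\<^sub>\<sigma> * \<gamma>)" using \<sigma>'_lip by (intro clock_bounds(4) t)
  then have \<Lambda>'_lip: "?\<Lambda>' \<le> T * K\<^sub>\<sigma> r + \<gamma> * (T * L\<^sub>\<sigma>)" by (simp add: algebra_simps)
  have "\<bar>?\<Lambda> - ?\<Lambda>'\<bar> \<le> T * (D\<^sub>\<sigma> r + L\<^sub>\<sigma> * \<gamma>)" using \<sigma>_diff by (intro clock_diff_le t)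
  then have diff: "\<bar>?\<Lambda> - ?\<Lambda>'\<bar> \<le> T * D\<^sub>\<sigma> r + \<gamma> * (T * L\<^sub>\<sigma>)" by (simp add: algebra_simps)
  have nonneg: "0 \<le> T * D\<^sub>\<sigma> r" "0 \<le> \<gamma> * (T * L\<^sub>\<sigma>)"
    using T L KD suprema_nonneg by (auto intro!: mult_nonneg_nonneg)
  obtain u where u: "0 \<le> u" "u \<le> T * K\<^sub>\<sigma> r" "\<bar>?\<Lambda> - u\<bar> \<le> T * D\<^sub>\<sigma> r" "\<bar>u - ?\<Lambda>'\<bar> \<le> \<gamma> * (T * L\<^sub>\<sigma>)"
    using intermediate_clock[OF diff nonneg clock_bounds(1,2)[OF t] \<Lambda> \<Lambda>'_lip] by blast
  have "T * K\<^sub>\<sigma> r \<le> T * K\<^sub>\<sigma> (r + r')" using KD T by simp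
  then have u': "u \<le> T * K\<^sub>\<sigma> (r + r')" using u by linarith
  have "\<bar>\<beta> ?\<Lambda> - \<beta> u\<bar> \<le> m * w \<epsilon> (T * K\<^sub>\<sigma> r) (T * D\<^sub>\<sigma> r)"
    by (rule increment_le_w_symmetric[OF \<epsilon> m \<beta> incr clock_bounds(1)[OF t] u(1) \<Lambda> u(2,3)])
  moreover have "\<bar>\<beta> u - \<beta> ?\<Lambda>'\<bar> \<le> m * w \<epsilon> (T * K\<^sub>\<sigma> (r + r')) (\<gamma> * (T * L\<^sub>\<sigma>))"
    by (rule increment_le_w_symmetric[OF \<epsilon> m \<beta> incr u(1) clock_bounds(2)[OF t] u' \<Lambda>' u(4)])
  ultimately show ?thesis by linarith
qed

lemma gap_bound:
  assumes \<epsilon>: "0 \<le> \<epsilon>" "\<epsilon> \<le> 1" and m: "0 \<le> m" and \<beta>: "continuous_on {0..} \<beta>"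
    and incr: "\<And>s t. 0 < s \<Longrightarrow> s < t \<Longrightarrow> \<bar>\<beta> t - \<beta> s\<bar> \<le> m * bm_modulus \<epsilon> t (t - s)"
  shows "\<gamma> \<le> 1 + 2 * exp (2 * L\<^sub>b * T) * (\<bar>x\<^sub>0 - x\<^sub>0'\<bar> + T * D\<^sub>b r
      + m * w \<epsilon> (T * K\<^sub>\<sigma> r) (T * D\<^sub>\<sigma> r) + m\<^sup>2 * (w \<epsilon> (T * K\<^sub>\<sigma> (r + r')) (T * L\<^sub>\<sigma>))\<^sup>2)"
proof -
  define C where "C = \<bar>x\<^sub>0 - x\<^sub>0'\<bar> + T * D\<^sub>b r + m * w \<epsilon> (T * K\<^sub>\<sigma> r) (T * D\<^sub>\<sigma> r)"
  define q where "q = m * w \<epsilon> (T * K\<^sub>\<sigma> (r + r')) (T * L\<^sub>\<sigma>)"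
  define E where "E = exp (L\<^sub>b * T)"
  have E: "1 \<le> E" using LBC_lipschitz_nonneg[OF LBC_b] T by (simp add: E_def)
  have E2: "exp (2 * L\<^sub>b * T) = E\<^sup>2" by (simp add: E_def power2_eq_square mult.assoc flip: exp_add)
  have C: "0 \<le> C"
    unfolding C_def using LBC_mono[OF LBC_b suprema_nonneg(1)] T m \<epsilon>
    by (intro add_nonneg_nonneg mult_nonneg_nonneg w_nonneg) auto
  have "\<gamma> \<le> 1 + 2 * E\<^sup>2 * (C + q\<^sup>2)"
  \<comment> \<open>Scaling \<open>w\<close> by \<open>\<gamma>\<close> requires
    \<open>1 \<le> \<gamma>\<close>; smaller gaps are covered by the summand 1.\<close>
  proof (cases "1 \<le> \<gamma>")
    case False
    moreover have "0 \<le> 2 * E\<^sup>2 * (C + q\<^sup>2)" using C by auto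
    ultimately show ?thesis by linarith
  next
    case True
    have "m * w \<epsilon> (T * K\<^sub>\<sigma> (r + r')) (\<gamma> * (T * L\<^sub>\<sigma>))
        \<le> m * (sqrt \<gamma> * w \<epsilon> (T * K\<^sub>\<sigma> (r + r')) (T * L\<^sub>\<sigma>))"
      by (rule mult_left_mono[OF w_scale[OF True \<epsilon>(1)] m])
    also have "\<dots> = sqrt \<gamma> * q" by (simp add: q_def)
    finally have "\<gamma> \<le> E * (\<bar>x\<^sub>0 - x\<^sub>0'\<bar> + T * D\<^sub>b r + (m * w \<epsilon> (T * K\<^sub>\<sigma> r) (T * D\<^sub>\<sigma> r) + sqrt \<gamma> * q))"
      unfolding E_def
      using clock_increment_le[OF \<epsilon> m \<beta> incr] by (intro gap_le) force
    then have 1: "\<gamma> \<le> E * C + sqrt \<gamma> * (E * q)" by (simp add: C_def algebra_simps)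
    \<comment> \<open>AM-GM: twice the mixed term is at most
      \<open>\<gamma> + E\<^sup>2 * q\<^sup>2\<close>, so doubling the inequality \<open>1\<close>
      lets one \<open>\<gamma>\<close> be absorbed on the left.\<close>
    have "0 \<le> (sqrt \<gamma> - E * q)\<^sup>2" by simp
    also have "\<dots> = \<gamma> - 2 * (sqrt \<gamma> * (E * q)) + E\<^sup>2 * q\<^sup>2"
      using True by (simp add: power2_diff power_mult_distrib)
    finally have "\<gamma> \<le> 2 * (E * C) + E\<^sup>2 * q\<^sup>2" using 1 by linarith
    \<comment> \<open>Both summands are given the common factor \<open>2 * E\<^sup>2\<close>, using
      \<open>1 \<le> E\<close>.\<close>
    also have "\<dots> \<le> 2 * (E\<^sup>2 * C) + 2 * (E\<^sup>2 * q\<^sup>2)"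
      using E C mult_right_mono[of E "E\<^sup>2" C] self_le_power[of E 2] by (intro add_mono) auto
    finally show ?thesis by (simp add: algebra_simps)
  qed
  then show ?thesis by (simp add: C_def q_def E2 power_mult_distrib)
qed

text \<open>This covers paths with \<open>M\<^sub>B = \<infinity>\<close>, for which the right-hand side may still be finite because
  \<open>\<infinity> * 0 = 0\<close> in \<^typ>\<open>ereal\<close>; the two clocks then coincide.\<close>

lemma gap_bound_degenerate:
  assumes \<epsilon>: "0 \<le> \<epsilon>"
    and "w \<epsilon> (T * K\<^sub>\<sigma> r) (T * D\<^sub>\<sigma> r) = 0" "w \<epsilon> (T * K\<^sub>\<sigma> (r + r')) (T * L\<^sub>\<sigma>) = 0"
  shows "\<gamma> \<le> 1 + 2 * exp (2 * L\<^sub>b * T) * (\<bar>x\<^sub>0 - x\<^sub>0'\<bar> + T * D\<^sub>b r)"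
proof -
  have L: "0 \<le> L\<^sub>\<sigma>" by (rule LBC_lipschitz_nonneg[OF LBC_\<sigma>])
  have KD: "0 \<le> D\<^sub>\<sigma> r" "0 \<le> K\<^sub>\<sigma> r" "K\<^sub>\<sigma> r \<le> K\<^sub>\<sigma> (r + r')"
    using LBC_mono[OF LBC_\<sigma>, of r "r + r'"] suprema_nonneg by auto
  have degenerate: "K\<^sub>\<sigma> r = 0 \<or> D\<^sub>\<sigma> r = 0" "K\<^sub>\<sigma> (r + r') = 0 \<or> L\<^sub>\<sigma> = 0"
    using assms T KD L by (auto simp: w_eq_0_iff mult_le_0_iff)
  have same: "\<bar>(\<sigma> s (X s \<omega>))\<^sup>2 - (\<sigma>' s (X' s \<omega>))\<^sup>2\<bar> \<le> 0" if s: "s \<in> {0..T}" for s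
  proof -
    have "(\<sigma> s (X s \<omega>))\<^sup>2 \<le> K\<^sub>\<sigma> r" "(\<sigma>' s (X s \<omega>))\<^sup>2 \<le> K\<^sub>\<sigma> r"
      using LBC_norm_le[OF LBC_\<sigma>, of s "X s \<omega>" r] path_bounds(1)[OF s] s by auto
    moreover have "(\<sigma>' s (X' s \<omega>))\<^sup>2 \<le> K\<^sub>\<sigma> (r + r')"
      using LBC_norm_le(2)[OF LBC_\<sigma>, of s "X' s \<omega>" "r + r'"] path_bounds(2)[OF s] suprema_nonneg s
      by simp
    moreover have "\<bar>(\<sigma> s (X s \<omega>))\<^sup>2 - (\<sigma>' s (X' s \<omega>))\<^sup>2\<bar> \<le> D\<^sub>\<sigma> r + L\<^sub>\<sigma> * \<bar>X s \<omega> - X' s \<omega>\<bar>"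
      using LBC_diff_le[OF LBC_\<sigma>, of s "X s \<omega>" r "X' s \<omega>"] path_bounds(1)[OF s] s by simp
    moreover have "\<bar>(\<sigma>' s (X s \<omega>))\<^sup>2 - (\<sigma>' s (X' s \<omega>))\<^sup>2\<bar> \<le> L\<^sub>\<sigma> * \<bar>X s \<omega> - X' s \<omega>\<bar>"
      using LBC_lipschitz[OF LBC_\<sigma>, of s "X s \<omega>" "X' s \<omega>"] s by simp
    moreover have "0 \<le> (\<sigma> s (X s \<omega>))\<^sup>2" "0 \<le> (\<sigma>' s (X s \<omega>))\<^sup>2" "0 \<le> (\<sigma>' s (X' s \<omega>))\<^sup>2" by auto
    \<comment> \<open>If \<open>D\<^sub>\<sigma> r\<close> and \<open>L\<^sub>\<sigma>\<close>
      vanish, the difference bound suffices. If \<open>K\<^sub>\<sigma> (r + r')\<close> vanishes,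
      so do \<open>K\<^sub>\<sigma> r\<close> and both squares. If \<open>K\<^sub>\<sigma> r\<close>
      and \<open>L\<^sub>\<sigma>\<close> vanish, \<open>\<sigma>'\<close> is zero along
      \<open>X\<close> and the Lipschitz bound carries this over to \<open>X'\<close>.\<close>
    ultimately show ?thesis
      using degenerate KD by (elim disjE; simp only: mult_zero_left)
  qed
  have clocks: "clock \<sigma> X t \<omega> = clock \<sigma>' X' t \<omega>" if "t \<in> {0..T}" for t
    using clock_diff_le[OF that same] by simp
  define C where "C = \<bar>x\<^sub>0 - x\<^sub>0'\<bar> + T * D\<^sub>b r"
  have C: "0 \<le> C" using LBC_mono(4)[OF LBC_b suprema_nonneg(1) order_refl] T by (simp add: C_def)
  have "\<gamma> \<le> exp (L\<^sub>b * T) * C"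
    using gap_le[of 0] clocks by (simp add: C_def)
  also have "\<dots> \<le> (2 * exp (2 * L\<^sub>b * T)) * C"
  proof (rule mult_right_mono[OF _ C])
    have "exp (L\<^sub>b * T) \<le> exp (2 * L\<^sub>b * T)"
      using LBC_lipschitz_nonneg[OF LBC_b] T by simp
    then show "exp (L\<^sub>b * T) \<le> 2 * exp (2 * L\<^sub>b * T)" using exp_ge_zero[of "2 * L\<^sub>b * T"] by linarith
  qed
  finally show ?thesis by (simp add: C_def)
qed

end

section \<open>The random constant \<open>M_B\<close> and the almost sure inequality\<close>

lemma M_B_nonneg:
  assumes "0 \<le> \<epsilon>"
  shows "0 \<le> M_B \<epsilon> B \<omega>"
  unfolding M_B_def
  \<comment> \<open>The pair is arbitrary: any single nonnegative quotient bounds the supremum from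
    below.\<close>
  by (rule SUP_upper2[of "(1, 2)"]) (use assms bm_modulus_nonneg[of 1 2 \<epsilon>] in auto)

lemma M_B_increment_le:
  assumes "M_B \<epsilon> B \<omega> = ereal m" "0 \<le> \<epsilon>" "0 < s" "s < t"
  shows "\<bar>B t \<omega> - B s \<omega>\<bar> \<le> m * bm_modulus \<epsilon> t (t - s)"
proof -
  have "ereal (\<bar>B t \<omega> - B s \<omega>\<bar> / bm_modulus \<epsilon> t \<bar>t - s\<bar>) \<le> M_B \<epsilon> B \<omega>"
    unfolding M_B_def by (rule SUP_upper2[of "(s, t)"]) (use assms in auto)
  moreover have "0 < bm_modulus \<epsilon> t (t - s)" using assms by (intro bm_modulus_pos) auto
  ultimately show ?thesis using assms by (simp add: divide_le_eq)
qed

theorem proposition3: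
  fixes M :: "'a measure"
    and B X X' :: "real \<Rightarrow> 'a \<Rightarrow> real"
    and b b' \<sigma> \<sigma>' :: "real \<Rightarrow> real \<Rightarrow> real"
    and K\<^sub>b D\<^sub>b K\<^sub>\<sigma> D\<^sub>\<sigma> :: "real \<Rightarrow> real"
    and \<epsilon> L\<^sub>b L\<^sub>\<sigma> x\<^sub>0 x\<^sub>0' T :: real
  assumes "0 < \<epsilon>" and "\<epsilon> < 1"
    and "standard_brownian_motion M B"
    and "LBC L\<^sub>b K\<^sub>b D\<^sub>b b b'"
    and "LBC L\<^sub>\<sigma> K\<^sub>\<sigma> D\<^sub>\<sigma> (\<lambda>t x. (\<sigma> t x)\<^sup>2) (\<lambda>t x. (\<sigma>' t x)\<^sup>2)"
    and "time_change_solution M B b \<sigma> x\<^sub>0 X"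
    and "time_change_solution M B b' \<sigma>' x\<^sub>0' X'"
    and "T > 0"
  shows "AE \<omega> in M.
    ereal (SUP t\<in>{0..T}. \<bar>X t \<omega> - X' t \<omega>\<bar>)
      \<le> 1 + ereal (2 * exp (2 * L\<^sub>b * T)) *
          (ereal \<bar>x\<^sub>0 - x\<^sub>0'\<bar>
           + ereal (T * D\<^sub>b (running_max X T \<omega>))
           + M_B \<epsilon> B \<omega> * ereal (w \<epsilon> (T * K\<^sub>\<sigma> (running_max X T \<omega>)) (T * D\<^sub>\<sigma> (running_max X T \<omega>)))
           + (M_B \<epsilon> B \<omega>)\<^sup>2
               * ereal ((w \<epsilon> (T * K\<^sub>\<sigma> (running_max X T \<omega> + running_max X' T \<omega>)) (T * L\<^sub>\<sigma>))\<^sup>2))"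
proof -
  have \<epsilon>: "0 \<le> \<epsilon>" "\<epsilon> \<le> 1" using assms(1,2) by auto
  have B: "AE \<omega> in M. continuous_on {0..} (\<lambda>t. B t \<omega>)"
    using assms(3) by (simp add: standard_brownian_motion_def)
  note X = conjunct2[OF assms(6)[unfolded time_change_solution_def]]
  note X' = conjunct2[OF assms(7)[unfolded time_change_solution_def]]
  show ?thesis
    using B X X'
  proof eventually_elim
    case (elim \<omega>)
    let ?r = "running_max X T \<omega>" and ?r' = "running_max X' T \<omega>"
    let ?w1 = "w \<epsilon> (T * K\<^sub>\<sigma> ?r) (T * D\<^sub>\<sigma> ?r)" and ?w2 = "w \<epsilon> (T * K\<^sub>\<sigma> (?r + ?r')) (T * L\<^sub>\<sigma>)"
    note bound = gap_bound[OF assms(4,5,8), of X \<omega> X' x\<^sub>0 "\<lambda>t. B t \<omega>" x\<^sub>0' \<epsilon>]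
    note degenerate = gap_bound_degenerate[OF assms(4,5,8), of X \<omega> X' x\<^sub>0 "\<lambda>t. B t \<omega>" x\<^sub>0' \<epsilon>]
    have nonneg: "0 \<le> M_B \<epsilon> B \<omega>" using \<epsilon>(1) by (rule M_B_nonneg)
    show ?case
    proof (cases "M_B \<epsilon> B \<omega>")
      case (real m)
      have "0 \<le> m" using nonneg real by simp
      then show ?thesis
        using bound[of m] elim \<epsilon> M_B_increment_le[OF real \<epsilon>(1)]
        by (simp add: real one_ereal_def power2_eq_square)
    next
      case PInf
      show ?thesis
      proof (cases "?w1 = 0 \<and> ?w2 = 0")
        case True
        then have "M_B \<epsilon> B \<omega> * ereal ?w1 = 0" "(M_B \<epsilon> B \<omega>)\<^sup>2 * ereal (?w2\<^sup>2) = 0"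
          by (simp_all flip: zero_ereal_def)
        moreover have "(SUP t\<in>{0..T}. \<bar>X t \<omega> - X' t \<omega>\<bar>)
            \<le> 1 + 2 * exp (2 * L\<^sub>b * T) * (\<bar>x\<^sub>0 - x\<^sub>0'\<bar> + T * D\<^sub>b ?r)"
          using True elim \<epsilon> by (intro degenerate) auto
        ultimately show ?thesis by (simp only: add_0_right) (simp add: one_ereal_def)
      next
        case False
        \<comment> \<open>Infinity times a positive real is infinite and the other summands are
          nonnegative or finite, so the right-hand side is infinite.\<close>
        then have "0 < ?w1 \<or> 0 < ?w2" using w_nonneg[OF \<epsilon>(1)] by (metis order_less_le)
        then have "M_B \<epsilon> B \<omega> * ereal ?w1 = \<infinity> \<or> (M_B \<epsilon> B \<omega>)\<^sup>2 * ereal (?w2\<^sup>2) = \<infinity>"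
          using PInf by (auto simp: power2_eq_square)
        moreover have "0 \<le> M_B \<epsilon> B \<omega> * ereal ?w1" "0 \<le> (M_B \<epsilon> B \<omega>)\<^sup>2 * ereal (?w2\<^sup>2)"
          using nonneg w_nonneg[OF \<epsilon>(1)] by auto
        ultimately have "ereal \<bar>x\<^sub>0 - x\<^sub>0'\<bar> + ereal (T * D\<^sub>b ?r) + M_B \<epsilon> B \<omega> * ereal ?w1
            + (M_B \<epsilon> B \<omega>)\<^sup>2 * ereal (?w2\<^sup>2) = \<infinity>"
          by auto
        then show ?thesis by (simp only:) simp
      qed
    next
      case MInf
      then show ?thesis using nonneg by simp
    qed
  qed
qed

end
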